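(* For $y\ge0$ let $\xi(y):=\sup\{x\in\mathbb{N}_0: f^*(x,y)=0\}$. Then $\xi^*:=\sup_{y\ge0}\xi(y)<\infty$.
   Context: Setting. $X=\mathbb{Z}$, $\beta\in(0,1)$ is a discount factor, $Z_1,Z_2,\ldots$ are i.i.d. integer-valued random variables with $\mathbb{P}(Z_n=k)=q_k$, $k\in\mathbb{Z}$; $Z$ denotes a generic copy. Standing assumptions: $\mathbb{E}Z^+<\infty$ (where $Z^+=\max\{Z,0\}$) and $\mathbb{P}(Z<0)>0$. Action sets: $A(x)=\{0,\ldots,x\}$ for $x\ge0$ and $A(x)=\{0\}$ for $x<0$; $D=\{(x,a):x\in X,a\in A(x)\}$. A policy $\pi=(\pi_k)_{k\ge0}$ is a sequence of maps assigning to each history $(x_0,a_0,\ldots,x_{k-1},a_{k-1},x_k)$ with $(x_m,a_m)\in D$ an action in $A(x_k)$; $\Pi$ is the set of all policies. Under $\pi$ and $x_0=x$, $a_k=\pi_k(x_0,a_0,\ldots,x_k)$, and $x_{k+1}=x_k-a_k+Z_{k+1}$ if $x_k\ge0$, $x_{k+1}=x_k$ if $x_k<0$; expectation is $\mathbb{E}_x^\pi$. The ruin time $\tau$ is the smallest $n\in\mathbb{N}_0$ with $x_n<0$ ($\tau=\infty$ if there is none). Fix $\gamma\in(0,1)$. For $x\in X$, $y\ge0$, $J(x,y)=\sup_{\pi\in\Pi}\mathbb{E}_x^\pi\big(\sum_{k=0}^{\tau-1}\beta^k a_k+y\big)^\gamma$, empty sums being $0$; thus $J(x,y)=y^\gamma$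 for $x<0$. For $x\in\mathbb{N}_0$, $y\ge0$ let $G(x,y)=\sum_{k=-\infty}^\infty J(x+k,y)q_k$. For $x\ge0$, $f^*(x,y)$ is the largest maximiser over $a\in A(x)$ of $a\mapsto\beta^\gamma G(x-a,\frac{a+y}{\beta})$. *)

theory Defs
  imports "HOL-Probability.Probability"
begin

definition actions :: "int \<Rightarrow> int set" where
  "actions x = (if x \<ge> 0 then {0..x} else {0})"

definition admissible_pairs :: "(int \<times> int) set" where
  "admissible_pairs = {(x, a). a \<in> actions x}"

text \<open>
  A history \<open>(x\<^sub>0, a\<^sub>0, \<dots>, x\<^sub>k\<^sub>-\<^sub>1, a\<^sub>k\<^sub>-\<^sub>1, x\<^sub>k)\<close> is split into the list of the first \<open>k\<close> state-action
  pairs, oldest first, and the current state; \<open>\<pi> k h x\<close> is the action chosen at time \<open>k\<close>.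
\<close>

type_synonym policy = "nat \<Rightarrow> (int \<times> int) list \<Rightarrow> int \<Rightarrow> int"

definition policies :: "policy set" where
  "policies = {\<pi>. \<forall>k h x. length h = k \<and> set h \<subseteq> admissible_pairs \<longrightarrow> \<pi> k h x \<in> actions x}"

text \<open>
  \<open>run \<pi> x z k\<close> is the history at time \<open>k\<close> under \<open>\<pi>\<close> from \<open>x\<^sub>0 = x\<close> along the noise path \<open>z\<close>.
  The noise is indexed from 1; \<open>z 0\<close> is never used.
\<close>

primrec run :: "policy \<Rightarrow> int \<Rightarrow> (nat \<Rightarrow> int) \<Rightarrow> nat \<Rightarrow> (int \<times> int) list \<times> int" where
  "run \<pi> x z 0 = ([], x)"
| "run \<pi> x z (Suc k) =
     (let (h, s) = run \<pi> x z k; a = \<pi> k h s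
      in (h @ [(s, a)], if s \<ge> 0 then s - a + z (Suc k) else s))"

definition state :: "policy \<Rightarrow> int \<Rightarrow> (nat \<Rightarrow> int) \<Rightarrow> nat \<Rightarrow> int" where
  "state \<pi> x z k = snd (run \<pi> x z k)"

definition action :: "policy \<Rightarrow> int \<Rightarrow> (nat \<Rightarrow> int) \<Rightarrow> nat \<Rightarrow> int" where
  "action \<pi> x z k = \<pi> k (fst (run \<pi> x z k)) (snd (run \<pi> x z k))"

text \<open>The infimum of the empty set in \<^typ>\<open>enat\<close> is \<open>\<infinity>\<close>.\<close>

definition ruin_time :: "policy \<Rightarrow> int \<Rightarrow> (nat \<Rightarrow> int) \<Rightarrow> enat" where
  "ruin_time \<pi> x z = Inf {enat n | n. state \<pi> x z n < 0}"

text \<open>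
  If ruin never occurs this is an infinite series of nonnegative terms. For integrable
  \<open>Z\<^sup>+\<close> and \<open>\<beta> < 1\<close> it converges almost surely, so the default value of a divergent
  series only matters on a null set.
\<close>

definition total_dividends :: "real \<Rightarrow> policy \<Rightarrow> int \<Rightarrow> (nat \<Rightarrow> int) \<Rightarrow> real" where
  "total_dividends \<beta> \<pi> x z =
     (\<Sum>k. if enat k < ruin_time \<pi> x z then \<beta> ^ k * real_of_int (action \<pi> x z k) else 0)"

text \<open>
  The expectation of a nonnegative variable, and hence the value function, is taken in
  \<^typ>\<open>ennreal\<close>, so that expectations, suprema and sums need no side conditions.
\<close>

definition J :: "'w measure \<Rightarrow> (nat \<Rightarrow> 'w \<Rightarrow> int) \<Rightarrow> real \<Rightarrow> real \<Rightarrow> int \<Rightarrow> real \<Rightarrow> ennreal" where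
  "J M Z \<beta> \<gamma> x y =
     (SUP \<pi>\<in>policies.
        \<integral>\<^sup>+\<omega>. ennreal ((total_dividends \<beta> \<pi> x (\<lambda>n. Z n \<omega>) + y) powr \<gamma>) \<partial>M)"

definition G ::
  "'w measure \<Rightarrow> (nat \<Rightarrow> 'w \<Rightarrow> int) \<Rightarrow> int pmf \<Rightarrow> real \<Rightarrow> real \<Rightarrow> int \<Rightarrow> real \<Rightarrow> ennreal" where
  "G M Z q \<beta> \<gamma> x y = (\<Sum>\<^sub>\<infinity>k\<in>UNIV. J M Z \<beta> \<gamma> (x + k) y * ennreal (pmf q k))"

definition f_star ::
  "'w measure \<Rightarrow> (nat \<Rightarrow> 'w \<Rightarrow> int) \<Rightarrow> int pmf \<Rightarrow> real \<Rightarrow> real \<Rightarrow> int \<Rightarrow> real \<Rightarrow> int" where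
  "f_star M Z q \<beta> \<gamma> x y =
     Max {a. is_arg_max
               (\<lambda>a. ennreal (\<beta> powr \<gamma>) * G M Z q \<beta> \<gamma> (x - a) ((real_of_int a + y) / \<beta>))
               (\<lambda>a. a \<in> actions x) a}"

text \<open>Both suprema are taken in \<^typ>\<open>enat\<close>: finiteness is part of the claim.\<close>

definition xi ::
  "'w measure \<Rightarrow> (nat \<Rightarrow> 'w \<Rightarrow> int) \<Rightarrow> int pmf \<Rightarrow> real \<Rightarrow> real \<Rightarrow> real \<Rightarrow> enat" where
  "xi M Z q \<beta> \<gamma> y = (SUP x\<in>{x::nat. f_star M Z q \<beta> \<gamma> (int x) y = 0}. enat x)"

definition xi_star ::
  "'w measure \<Rightarrow> (nat \<Rightarrow> 'w \<Rightarrow> int) \<Rightarrow> int pmf \<Rightarrow> real \<Rightarrow> real \<Rightarrow> enat" where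
  "xi_star M Z q \<beta> \<gamma> = (SUP y\<in>{0..}. xi M Z q \<beta> \<gamma> y)"

end

theory Submission
  imports Defs
begin

text \<open>
  From a large surplus it is never uniquely optimal to pay nothing: paying out the whole surplus
  is then at least as good, whatever has been paid before. Write \<open>m = E Z\<^sup>+\<close>.
  Along every path the discounted dividends from \<open>x\<close> are at most
  \<open>x\<^sup>+ + (\<Sum>k\<ge>1. \<beta>\<^sup>k Z\<^sub>k\<^sup>+)\<close>, because only money that has come in can be paid out and
  discounting only makes it smaller. Jensen's inequality for the concave power function turns this
  into \<open>J(x,y) \<le> (x\<^sup>+ + y + \<beta>m/(1-\<beta>))\<^sup>\<gamma>\<close> (\<open>J_upper\<close>), and a second application, now to the
  next increment, gives \<open>G(x,y) \<le> (x + y + m/(1-\<beta>))\<^sup>\<gamma>\<close> for \<open>x \<ge> 0\<close> (\<open>G_upper\<close>).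
  In the other direction never paying again yields \<open>G(x,y) \<ge> y\<^sup>\<gamma>\<close> (\<open>G_lower\<close>).

  Paying \<open>0\<close> leads to \<open>G(x, y/\<beta>)\<close> and paying \<open>x\<close> leads to \<open>G(0, (x+y)/\<beta>)\<close>. By these bounds the
  latter is at least as large as soon as
  \<open>x + y/\<beta> + m/(1-\<beta>) \<le> (x+y)/\<beta>\<close>, that is \<open>x \<ge> \<beta>m/(1-\<beta>)\<^sup>2\<close>. The amount \<open>y\<close> cancels, which is why
  the threshold is uniform in \<open>y\<close>. Beyond it \<open>0\<close> cannot be the largest maximiser.
\<close>

section \<open>Integration\<close>

text \<open>
  A concave function lies below its tangent at \<open>b\<close>. For the power function this is Young's inequality
  for \<open>u/b\<close> and \<open>1\<close>, scaled by \<open>b\<^sup>\<gamma>\<close>.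
\<close>

lemma powr_le_tangent:
  fixes u b \<gamma> :: real
  assumes "0 \<le> u" "0 < b" "0 < \<gamma>" "\<gamma> < 1"
  shows "u powr \<gamma> \<le> (1 - \<gamma>) * b powr \<gamma> + \<gamma> * b powr (\<gamma> - 1) * u"
proof (cases "u = 0")
  case True
  then show ?thesis using assms by simp
next
  case False
  have "(u / b) powr \<gamma> * 1 powr (1 - \<gamma>) \<le> \<gamma> * (u / b) + (1 - \<gamma>) * 1"
    using assms False by (intro Youngs_inequality_0) auto
  then have "b powr \<gamma> * (u / b) powr \<gamma> \<le> b powr \<gamma> * (\<gamma> * (u / b) + (1 - \<gamma>))"
    by (intro mult_left_mono) auto
  moreover have "b powr \<gamma> * (u / b) powr \<gamma> = u powr \<gamma>"
    using assms by (simp add: powr_divide)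
  moreover have "b powr (\<gamma> - 1) = b powr \<gamma> / b"
    using assms by (simp add: powr_diff)
  ultimately show ?thesis
    by (simp add: algebra_simps)
qed

text \<open>
  Jensen's inequality for the power function, obtained by integrating the tangent at \<open>b\<close>. Both
  coefficients of the tangent are nonnegative, so the whole computation takes place in
  \<^typ>\<open>ennreal\<close>. At \<open>b = 0\<close> there is no tangent, but then \<open>f\<close> vanishes almost everywhere.
\<close>

lemma (in prob_space) nn_integral_powr_le:
  fixes f :: "'a \<Rightarrow> real"
  assumes [measurable]: "f \<in> borel_measurable M"
    and nonneg: "\<And>\<omega>. 0 \<le> f \<omega>"
    and \<gamma>: "0 < \<gamma>" "\<gamma> < 1"
    and "0 \<le> b" and le: "(\<integral>\<^sup>+\<omega>. ennreal (f \<omega>) \<partial>M) \<le> ennreal b"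
  shows "(\<integral>\<^sup>+\<omega>. ennreal (f \<omega> powr \<gamma>) \<partial>M) \<le> ennreal (b powr \<gamma>)"
proof (cases "b = 0")
  case True
  then have "(\<integral>\<^sup>+\<omega>. ennreal (f \<omega>) \<partial>M) = 0"
    using le by simp
  then have "AE \<omega> in M. ennreal (f \<omega>) = 0"
    by (simp add: nn_integral_0_iff_AE)
  then have "AE \<omega> in M. ennreal (f \<omega> powr \<gamma>) = 0"
    by eventually_elim (use nonneg in \<open>simp add: order_antisym\<close>)
  then have "(\<integral>\<^sup>+\<omega>. ennreal (f \<omega> powr \<gamma>) \<partial>M) = (\<integral>\<^sup>+\<omega>. 0 \<partial>M)"
    by (rule nn_integral_cong_AE)
  then show ?thesis by simp
next
  case False
  then have b: "0 < b" using \<open>0 \<le> b\<close> by simp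
  let ?c = "(1 - \<gamma>) * b powr \<gamma>" and ?d = "\<gamma> * b powr (\<gamma> - 1)"
  have c: "0 \<le> ?c" and d: "0 \<le> ?d" using \<gamma> by auto
  have "(\<integral>\<^sup>+\<omega>. ennreal (f \<omega> powr \<gamma>) \<partial>M) \<le> (\<integral>\<^sup>+\<omega>. ennreal ?c + ennreal ?d * ennreal (f \<omega>) \<partial>M)"
  proof (rule nn_integral_mono)
    fix \<omega>
    have "ennreal (f \<omega> powr \<gamma>) \<le> ennreal (?c + ?d * f \<omega>)"
      using powr_le_tangent[OF nonneg b \<gamma>] by (rule ennreal_leI)
    also have "\<dots> = ennreal ?c + ennreal ?d * ennreal (f \<omega>)"
      using c d nonneg by (simp add: ennreal_mult[symmetric] ennreal_plus[symmetric] del: ennreal_plus)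
    finally show "ennreal (f \<omega> powr \<gamma>) \<le> ennreal ?c + ennreal ?d * ennreal (f \<omega>)" .
  qed
  also have "\<dots> = ennreal ?c + ennreal ?d * (\<integral>\<^sup>+\<omega>. ennreal (f \<omega>) \<partial>M)"
    by (simp add: nn_integral_add nn_integral_cmult emeasure_space_1)
  also have "\<dots> \<le> ennreal ?c + ennreal ?d * ennreal b"
    by (intro add_left_mono mult_left_mono le) auto
  also have "\<dots> = ennreal (?c + ?d * b)"
    using c d b by (simp add: ennreal_mult[symmetric] ennreal_plus[symmetric] del: ennreal_plus)
  also have "?c + ?d * b = b powr \<gamma>"
    using b by (simp add: powr_diff algebra_simps)
  finally show ?thesis .
qed

text \<open>
  Finite partial sums are integrals over finite sets, which gives one inequality. For the other, an
  enumeration of the integers turns the integral into a series, whose partial sums are again finite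
  sums.
\<close>

lemma infsum_eq_nn_integral_count_space_int:
  fixes f :: "int \<Rightarrow> ennreal"
  shows "(\<Sum>\<^sub>\<infinity>k\<in>UNIV. f k) = (\<integral>\<^sup>+k. f k \<partial>count_space UNIV)"
proof (rule antisym)
  have "sum f F \<le> (\<integral>\<^sup>+k. f k \<partial>count_space UNIV)" if "finite F" for F
  proof -
    have "sum f F = (\<integral>\<^sup>+k. f k * indicator F k \<partial>count_space UNIV)"
      using that by (subst nn_integral_count_space'[of F]) auto
    also have "\<dots> \<le> (\<integral>\<^sup>+k. f k \<partial>count_space UNIV)"
      by (intro nn_integral_mono) (auto simp: indicator_def)
    finally show ?thesis .
  qed
  then show "(\<Sum>\<^sub>\<infinity>k\<in>UNIV. f k) \<le> (\<integral>\<^sup>+k. f k \<partial>count_space UNIV)"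
    by (auto simp: nonneg_infsum_complete intro!: SUP_least)
next
  have "(\<integral>\<^sup>+k. f k \<partial>count_space UNIV) = (\<integral>\<^sup>+i. f (int_decode i) \<partial>count_space UNIV)"
    by (rule nn_integral_bij_count_space[symmetric]) (rule bij_int_decode)
  also have "\<dots> = (\<Sum>i. f (int_decode i))"
    by (rule nn_integral_count_space_nat)
  also have "\<dots> \<le> (\<Sum>\<^sub>\<infinity>k\<in>UNIV. f k)"
  proof (rule suminf_le_const)
    fix n
    have "(\<Sum>i<n. f (int_decode i)) = sum f (int_decode ` {..<n})"
      by (subst sum.reindex) (auto intro: inj_on_subset[OF inj_int_decode])
    also have "\<dots> \<le> (\<Sum>\<^sub>\<infinity>k\<in>UNIV. f k)"
      by (auto simp: nonneg_infsum_complete intro!: SUP_upper)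
    finally show "(\<Sum>i<n. f (int_decode i)) \<le> (\<Sum>\<^sub>\<infinity>k\<in>UNIV. f k)" .
  qed simp
  finally show "(\<integral>\<^sup>+k. f k \<partial>count_space UNIV) \<le> (\<Sum>\<^sub>\<infinity>k\<in>UNIV. f k)" .
qed

lemma G_eq_nn_integral: "G M Z q \<beta> \<gamma> x y = (\<integral>\<^sup>+k. J M Z \<beta> \<gamma> (x + k) y \<partial>measure_pmf q)"
  unfolding G_def infsum_eq_nn_integral_count_space_int nn_integral_measure_pmf
  by (simp add: mult.commute)

section \<open>Dividends along a path\<close>

lemma history_admissible:
  assumes "\<pi> \<in> policies"
  shows "length (fst (run \<pi> x z k)) = k \<and> set (fst (run \<pi> x z k)) \<subseteq> admissible_pairs"
proof (induction k)
  case (Suc k)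
  then have "\<pi> k (fst (run \<pi> x z k)) (snd (run \<pi> x z k)) \<in> actions (snd (run \<pi> x z k))"
    using assms unfolding policies_def by blast
  then show ?case
    using Suc by (auto simp: split_beta Let_def admissible_pairs_def)
qed simp

lemma action_admissible:
  assumes "\<pi> \<in> policies"
  shows "action \<pi> x z k \<in> actions (state \<pi> x z k)"
  using assms history_admissible[OF assms, of x z k]
  unfolding policies_def action_def state_def by blast

lemma state_Suc:
  "state \<pi> x z (Suc k) =
     (if state \<pi> x z k \<ge> 0 then state \<pi> x z k - action \<pi> x z k + z (Suc k) else state \<pi> x z k)"
  by (simp add: state_def action_def split_beta Let_def)

definition dividend :: "policy \<Rightarrow> int \<Rightarrow> (nat \<Rightarrow> int) \<Rightarrow> nat \<Rightarrow> int" where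
  "dividend \<pi> x z k = (if enat k < ruin_time \<pi> x z then action \<pi> x z k else 0)"

lemma total_dividends_eq:
  "total_dividends \<beta> \<pi> x z = (\<Sum>k. \<beta> ^ k * real_of_int (dividend \<pi> x z k))"
  unfolding total_dividends_def dividend_def by (rule arg_cong[where f = suminf]) auto

lemma dividend_nonneg: "\<pi> \<in> policies \<Longrightarrow> 0 \<le> dividend \<pi> x z k"
  using action_admissible[of \<pi> x z k] by (auto simp: dividend_def actions_def split: if_splits)

lemma dividend_le_state: "\<pi> \<in> policies \<Longrightarrow> dividend \<pi> x z k \<le> max (state \<pi> x z k) 0"
  using action_admissible[of \<pi> x z k] by (auto simp: dividend_def actions_def split: if_splits)

lemma dividend_le_action: "\<pi> \<in> policies \<Longrightarrow> dividend \<pi> x z k \<le> action \<pi> x z k"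
  using action_admissible[of \<pi> x z k] by (auto simp: dividend_def actions_def split: if_splits)

text \<open>
  The budget of the company: what has been paid plus what is still there never exceeds what has
  come in, all in present values. Keeping the current surplus on the left makes the bound
  inductive, and discounting the surplus kept from one period to the next only lowers the left side.
\<close>

lemma discounted_budget:
  assumes \<pi>: "\<pi> \<in> policies" and \<beta>: "0 < \<beta>" "\<beta> < 1"
  shows "(\<Sum>k<n. \<beta> ^ k * real_of_int (dividend \<pi> x z k)) + \<beta> ^ n * real_of_int (max (state \<pi> x z n) 0)
    \<le> real_of_int (max x 0) + (\<Sum>k<n. \<beta> ^ Suc k * real_of_int (max (z (Suc k)) 0))"
proof (induction n)
  case 0
  then show ?case by (simp add: state_def)
next
  case (Suc n)
  let ?s = "state \<pi> x z n" and ?d = "dividend \<pi> x z n"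
  let ?z = "max (z (Suc n)) 0"
  have "max (state \<pi> x z (Suc n)) 0 \<le> max ?s 0 - ?d + ?z"
    using dividend_le_action[OF \<pi>, of x z n] dividend_le_state[OF \<pi>, of x z n]
    by (auto simp: state_Suc)
  then have next_state: "real_of_int (max (state \<pi> x z (Suc n)) 0)
      \<le> (real_of_int (max ?s 0) - real_of_int ?d) + real_of_int ?z"
    by linarith
  have kept: "0 \<le> real_of_int (max ?s 0) - real_of_int ?d"
    using dividend_le_state[OF \<pi>, of x z n] by linarith
  have "\<beta> * real_of_int (max (state \<pi> x z (Suc n)) 0)
      \<le> \<beta> * ((real_of_int (max ?s 0) - real_of_int ?d) + real_of_int ?z)"
    using next_state \<beta> by (intro mult_left_mono) auto
  also have "\<dots> \<le> (real_of_int (max ?s 0) - real_of_int ?d) + \<beta> * real_of_int ?z"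
    using mult_right_mono[OF less_imp_le[OF \<beta>(2)] kept] by (simp add: distrib_left)
  finally have "\<beta> ^ n * (\<beta> * real_of_int (max (state \<pi> x z (Suc n)) 0))
      \<le> \<beta> ^ n * ((real_of_int (max ?s 0) - real_of_int ?d) + \<beta> * real_of_int ?z)"
    using \<beta> by (intro mult_left_mono) auto
  then show ?case
    using Suc.IH by (simp add: algebra_simps)
qed

text \<open>
  Where the discounted inflow converges, the budget bounds the partial sums of the dividends. Hence
  their series converges as well, and its sum is a genuine limit rather than a default value.
\<close>

lemma total_dividends_bounds:
  assumes \<pi>: "\<pi> \<in> policies" and \<beta>: "0 < \<beta>" "\<beta> < 1"
    and summable: "summable (\<lambda>k. \<beta> ^ Suc k * real_of_int (max (z (Suc k)) 0))"
  shows "0 \<le> total_dividends \<beta> \<pi> x z"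
    and "total_dividends \<beta> \<pi> x z
      \<le> real_of_int (max x 0) + (\<Sum>k. \<beta> ^ Suc k * real_of_int (max (z (Suc k)) 0))"
proof -
  let ?d = "\<lambda>k. \<beta> ^ k * real_of_int (dividend \<pi> x z k)"
  let ?B = "real_of_int (max x 0) + (\<Sum>k. \<beta> ^ Suc k * real_of_int (max (z (Suc k)) 0))"
  have nonneg: "0 \<le> ?d k" for k
    using dividend_nonneg[OF \<pi>] \<beta> by simp
  have bounded: "(\<Sum>k<n. ?d k) \<le> ?B" for n
  proof -
    have "(\<Sum>k<n. ?d k) \<le> (\<Sum>k<n. ?d k) + \<beta> ^ n * real_of_int (max (state \<pi> x z n) 0)"
      using \<beta> by simp
    also have "\<dots> \<le> real_of_int (max x 0) + (\<Sum>k<n. \<beta> ^ Suc k * real_of_int (max (z (Suc k)) 0))"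
      by (rule discounted_budget[OF \<pi> \<beta>])
    also have "\<dots> \<le> ?B"
      using \<beta> by (intro add_left_mono sum_le_suminf[OF summable]) auto
    finally show ?thesis .
  qed
  have sm: "summable ?d"
    by (rule summableI_nonneg_bounded[OF nonneg bounded])
  show "0 \<le> total_dividends \<beta> \<pi> x z"
    unfolding total_dividends_eq by (rule suminf_nonneg[OF sm nonneg])
  show "total_dividends \<beta> \<pi> x z \<le> ?B"
    unfolding total_dividends_eq by (rule suminf_le_const[OF sm bounded])
qed

lemma zero_policy: "(\<lambda>_ _ _. 0) \<in> policies"
  by (simp add: policies_def actions_def)

lemma total_dividends_zero_policy: "total_dividends \<beta> (\<lambda>_ _ _. 0) x z = 0"
  by (simp add: total_dividends_def action_def cong: if_cong)

section \<open>Bounds on the value function\<close>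

locale dividend_model = prob_space M
  for M :: "'w measure" +
  fixes Z :: "nat \<Rightarrow> 'w \<Rightarrow> int" and q :: "int pmf" and \<beta> \<gamma> :: real
  assumes Z_measurable [measurable]: "n \<ge> 1 \<Longrightarrow> Z n \<in> measurable M (count_space UNIV)"
    and Z_law: "n \<ge> 1 \<Longrightarrow> measure M {\<omega> \<in> space M. Z n \<omega> = k} = pmf q k"
    and integrable_pos: "integrable (measure_pmf q) (\<lambda>z. real_of_int (max z 0))"
    and \<beta>: "0 < \<beta>" "\<beta> < 1"
    and \<gamma>: "0 < \<gamma>" "\<gamma> < 1"
begin

definition mean_pos :: real where
  "mean_pos = (\<integral>z. real_of_int (max z 0) \<partial>measure_pmf q)"

lemma mean_pos_nonneg: "0 \<le> mean_pos"
  unfolding mean_pos_def by (rule integral_nonneg_AE) simp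

lemma nn_integral_pos: "(\<integral>\<^sup>+z. ennreal (real_of_int (max z 0)) \<partial>measure_pmf q) = ennreal mean_pos"
  unfolding mean_pos_def by (rule nn_integral_eq_integral[OF integrable_pos]) simp

lemma distr_Z:
  assumes n: "n \<ge> 1"
  shows "distr M (count_space UNIV) (Z n) = measure_pmf q"
proof (rule measure_eqI_countable[where A = UNIV])
  fix k :: int
  have "emeasure (distr M (count_space UNIV) (Z n)) {k} = emeasure M {\<omega> \<in> space M. Z n \<omega> = k}"
    using n by (subst emeasure_distr) (auto intro!: arg_cong[where f = "emeasure M"])
  also have "\<dots> = emeasure (measure_pmf q) {k}"
    using Z_law[OF n] by (simp add: emeasure_eq_measure emeasure_pmf_single)
  finally show "emeasure (distr M (count_space UNIV) (Z n)) {k} = emeasure (measure_pmf q) {k}" .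
qed auto

lemma nn_integral_Z:
  assumes n: "n \<ge> 1"
  shows "(\<integral>\<^sup>+\<omega>. ennreal (real_of_int (max (Z n \<omega>) 0)) \<partial>M) = ennreal mean_pos"
proof -
  have "(\<integral>\<^sup>+\<omega>. ennreal (real_of_int (max (Z n \<omega>) 0)) \<partial>M)
      = (\<integral>\<^sup>+z. ennreal (real_of_int (max z 0)) \<partial>distr M (count_space UNIV) (Z n))"
    using n by (subst nn_integral_distr) auto
  then show ?thesis
    by (simp only: distr_Z[OF n] nn_integral_pos)
qed

definition discounted_inflow :: "'w \<Rightarrow> real" where
  "discounted_inflow \<omega> = (\<Sum>k. \<beta> ^ Suc k * real_of_int (max (Z (Suc k) \<omega>) 0))"

lemma nn_integral_discounted_series:
  "(\<integral>\<^sup>+\<omega>. (\<Sum>k. ennreal (\<beta> ^ Suc k * real_of_int (max (Z (Suc k) \<omega>) 0))) \<partial>M)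
     = ennreal (\<beta> * mean_pos / (1 - \<beta>))"
proof -
  have "(\<integral>\<^sup>+\<omega>. (\<Sum>k. ennreal (\<beta> ^ Suc k * real_of_int (max (Z (Suc k) \<omega>) 0))) \<partial>M)
      = (\<Sum>k. \<integral>\<^sup>+\<omega>. ennreal (\<beta> ^ Suc k * real_of_int (max (Z (Suc k) \<omega>) 0)) \<partial>M)"
    by (rule nn_integral_suminf) measurable
  also have "\<dots> = (\<Sum>k. ennreal (\<beta> ^ k * (\<beta> * mean_pos)))"
  proof (rule arg_cong[where f = suminf], rule ext)
    fix k
    have "(\<integral>\<^sup>+\<omega>. ennreal (\<beta> ^ Suc k * real_of_int (max (Z (Suc k) \<omega>) 0)) \<partial>M)
        = (\<integral>\<^sup>+\<omega>. ennreal (\<beta> ^ Suc k) * ennreal (real_of_int (max (Z (Suc k) \<omega>) 0)) \<partial>M)"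
      using \<beta> by (intro nn_integral_cong ennreal_mult) auto
    also have "\<dots> = ennreal (\<beta> ^ Suc k) * ennreal mean_pos"
      by (subst nn_integral_cmult) (auto simp: nn_integral_Z)
    also have "\<dots> = ennreal (\<beta> ^ Suc k * mean_pos)"
      using \<beta> mean_pos_nonneg by (intro ennreal_mult[symmetric]) auto
    finally show "(\<integral>\<^sup>+\<omega>. ennreal (\<beta> ^ Suc k * real_of_int (max (Z (Suc k) \<omega>) 0)) \<partial>M)
        = ennreal (\<beta> ^ k * (\<beta> * mean_pos))"
      by (simp add: mult_ac)
  qed
  also have "\<dots> = ennreal (1 / (1 - \<beta>) * (\<beta> * mean_pos))"
    using \<beta> mean_pos_nonneg by (intro suminf_ennreal_eq sums_mult2 geometric_sums) auto
  finally show ?thesis by simp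
qed

lemma AE_discounted_series_finite:
  "AE \<omega> in M. (\<Sum>k. ennreal (\<beta> ^ Suc k * real_of_int (max (Z (Suc k) \<omega>) 0))) \<noteq> \<infinity>"
  by (rule nn_integral_noteq_infinite) (simp_all add: nn_integral_discounted_series del: power_Suc)

lemma AE_summable_inflow:
  "AE \<omega> in M. summable (\<lambda>k. \<beta> ^ Suc k * real_of_int (max (Z (Suc k) \<omega>) 0))"
  using AE_discounted_series_finite
  by eventually_elim
    (rule summable_suminf_not_top, use \<beta> in \<open>auto simp del: power_Suc\<close>)

lemma discounted_inflow_measurable [measurable]: "discounted_inflow \<in> borel_measurable M"
  unfolding discounted_inflow_def by measurable

lemma nn_integral_discounted_inflow:
  "(\<integral>\<^sup>+\<omega>. ennreal (discounted_inflow \<omega>) \<partial>M) = ennreal (\<beta> * mean_pos / (1 - \<beta>))"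
proof -
  have "(\<integral>\<^sup>+\<omega>. ennreal (discounted_inflow \<omega>) \<partial>M)
      = (\<integral>\<^sup>+\<omega>. (\<Sum>k. ennreal (\<beta> ^ Suc k * real_of_int (max (Z (Suc k) \<omega>) 0))) \<partial>M)"
  proof (rule nn_integral_cong_AE)
    show "AE \<omega> in M. ennreal (discounted_inflow \<omega>)
        = (\<Sum>k. ennreal (\<beta> ^ Suc k * real_of_int (max (Z (Suc k) \<omega>) 0)))"
      using AE_discounted_series_finite unfolding discounted_inflow_def
      by eventually_elim
        (rule suminf_ennreal[symmetric], use \<beta> in \<open>auto simp del: power_Suc\<close>)
  qed
  then show ?thesis
    by (simp only: nn_integral_discounted_series)
qed

text \<open>
  The pathwise bound does not involve the policy, so Jensen's inequality for the bound takes care of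
  all policies at once. Only the bound has to be measurable: for a lower integrand the upper
  estimate of the integral is mere monotonicity.
\<close>

lemma J_upper:
  assumes y: "0 \<le> y"
  shows "J M Z \<beta> \<gamma> x y \<le> ennreal ((real_of_int (max x 0) + y + \<beta> * mean_pos / (1 - \<beta>)) powr \<gamma>)"
  unfolding J_def
proof (rule SUP_least)
  fix \<pi> assume \<pi>: "\<pi> \<in> policies"
  \<comment> \<open>Where the series of the inflow diverges its value is unspecified and might be negative.\<close>
  let ?x = "real_of_int (max x 0)" and ?W = "\<lambda>\<omega>. max (discounted_inflow \<omega>) 0"
  let ?C = "\<beta> * mean_pos / (1 - \<beta>)"
  have C: "0 \<le> ?C"
    using \<beta> mean_pos_nonneg by simp
  have "(\<integral>\<^sup>+\<omega>. ennreal ((total_dividends \<beta> \<pi> x (\<lambda>n. Z n \<omega>) + y) powr \<gamma>) \<partial>M)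
      \<le> (\<integral>\<^sup>+\<omega>. ennreal ((?x + y + ?W \<omega>) powr \<gamma>) \<partial>M)"
  proof (rule nn_integral_mono_AE)
    show "AE \<omega> in M. ennreal ((total_dividends \<beta> \<pi> x (\<lambda>n. Z n \<omega>) + y) powr \<gamma>)
        \<le> ennreal ((?x + y + ?W \<omega>) powr \<gamma>)"
      using AE_summable_inflow
    proof eventually_elim
      case (elim \<omega>)
      note bounds = total_dividends_bounds[OF \<pi> \<beta> elim, of x]
      have "total_dividends \<beta> \<pi> x (\<lambda>n. Z n \<omega>) + y \<le> ?x + y + ?W \<omega>"
        using bounds(2) by (simp add: discounted_inflow_def del: power_Suc)
      then show ?case
        using bounds(1) y \<gamma> by (intro ennreal_leI powr_mono2) auto
    qed
  qed
  also have "\<dots> \<le> ennreal ((?x + y + ?C) powr \<gamma>)"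
  proof (rule nn_integral_powr_le)
    have "(\<integral>\<^sup>+\<omega>. ennreal (?x + y + ?W \<omega>) \<partial>M)
        = (\<integral>\<^sup>+\<omega>. ennreal (?x + y) + ennreal (discounted_inflow \<omega>) \<partial>M)"
      using y by (intro nn_integral_cong) (subst ennreal_plus, auto simp: max_def ennreal_neg)
    also have "\<dots> = ennreal (?x + y) + ennreal ?C"
      by (simp add: nn_integral_add nn_integral_discounted_inflow emeasure_space_1)
    also have "\<dots> = ennreal (?x + y + ?C)"
      using y C by (intro ennreal_plus[symmetric]) auto
    finally show "(\<integral>\<^sup>+\<omega>. ennreal (?x + y + ?W \<omega>) \<partial>M) \<le> ennreal (?x + y + ?C)"
      by simp
  qed (use y C \<gamma> in auto)
  finally show "(\<integral>\<^sup>+\<omega>. ennreal ((total_dividends \<beta> \<pi> x (\<lambda>n. Z n \<omega>) + y) powr \<gamma>) \<partial>M)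
      \<le> ennreal ((?x + y + ?C) powr \<gamma>)" .
qed

lemma J_lower: "ennreal (y powr \<gamma>) \<le> J M Z \<beta> \<gamma> x y"
  unfolding J_def
  by (rule SUP_upper2[OF zero_policy]) (simp add: total_dividends_zero_policy emeasure_space_1)

lemma G_upper:
  assumes x: "0 \<le> x" and y: "0 \<le> y"
  shows "G M Z q \<beta> \<gamma> x y \<le> ennreal ((real_of_int x + y + mean_pos / (1 - \<beta>)) powr \<gamma>)"
proof -
  let ?C = "\<beta> * mean_pos / (1 - \<beta>)" and ?z = "\<lambda>k::int. real_of_int (max k 0)"
  have C: "0 \<le> ?C"
    using \<beta> mean_pos_nonneg by simp
  have "G M Z q \<beta> \<gamma> x y \<le> (\<integral>\<^sup>+k. ennreal ((real_of_int x + y + ?C + ?z k) powr \<gamma>) \<partial>measure_pmf q)"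
    unfolding G_eq_nn_integral
  proof (rule nn_integral_mono)
    fix k
    have "J M Z \<beta> \<gamma> (x + k) y \<le> ennreal ((real_of_int (max (x + k) 0) + y + ?C) powr \<gamma>)"
      by (rule J_upper[OF y])
    also have "\<dots> \<le> ennreal ((real_of_int x + y + ?C + ?z k) powr \<gamma>)"
      using x y C \<gamma> by (intro ennreal_leI powr_mono2) (auto simp: max_def)
    finally show "J M Z \<beta> \<gamma> (x + k) y \<le> ennreal ((real_of_int x + y + ?C + ?z k) powr \<gamma>)" .
  qed
  also have "\<dots> \<le> ennreal ((real_of_int x + y + ?C + mean_pos) powr \<gamma>)"
  proof (rule measure_pmf.nn_integral_powr_le)
    have "(\<integral>\<^sup>+k. ennreal (real_of_int x + y + ?C + ?z k) \<partial>measure_pmf q)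
        = (\<integral>\<^sup>+k. ennreal (real_of_int x + y + ?C) + ennreal (?z k) \<partial>measure_pmf q)"
      using x y C by (intro nn_integral_cong ennreal_plus) auto
    also have "\<dots> = ennreal (real_of_int x + y + ?C) + ennreal mean_pos"
      by (subst nn_integral_add) (auto simp: nn_integral_pos)
    also have "\<dots> = ennreal (real_of_int x + y + ?C + mean_pos)"
      using x y C mean_pos_nonneg by (intro ennreal_plus[symmetric]) auto
    finally show "(\<integral>\<^sup>+k. ennreal (real_of_int x + y + ?C + ?z k) \<partial>measure_pmf q)
        \<le> ennreal (real_of_int x + y + ?C + mean_pos)"
      by simp
  qed (use x y C \<gamma> mean_pos_nonneg in auto)
  also have "real_of_int x + y + ?C + mean_pos = real_of_int x + y + mean_pos / (1 - \<beta>)"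
    using \<beta> by (simp add: field_simps)
  finally show ?thesis .
qed

lemma G_lower: "ennreal (y powr \<gamma>) \<le> G M Z q \<beta> \<gamma> x y"
proof -
  have "ennreal (y powr \<gamma>) = (\<integral>\<^sup>+k. ennreal (y powr \<gamma>) \<partial>measure_pmf q)"
    by simp
  also have "\<dots> \<le> G M Z q \<beta> \<gamma> x y"
    unfolding G_eq_nn_integral by (intro nn_integral_mono J_lower)
  finally show ?thesis .
qed

section \<open>Paying out beyond the threshold\<close>

definition threshold :: real where
  "threshold = \<beta> * mean_pos / (1 - \<beta>)\<^sup>2"

lemma paying_all_beats_waiting:
  assumes x: "0 \<le> x" "threshold \<le> real_of_int x" and y: "0 \<le> y"
  shows "G M Z q \<beta> \<gamma> x (y / \<beta>) \<le> G M Z q \<beta> \<gamma> 0 ((real_of_int x + y) / \<beta>)"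
proof -
  have "\<beta> * mean_pos \<le> real_of_int x * (1 - \<beta>)\<^sup>2"
    using x(2) \<beta> by (simp add: threshold_def divide_le_eq)
  then have "\<beta> * mean_pos / (1 - \<beta>) \<le> real_of_int x * (1 - \<beta>)"
    using \<beta> by (simp add: divide_le_eq power2_eq_square mult_ac)
  \<comment> \<open>\<open>x (1/\<beta> - 1)\<close> is the gain from not discounting \<open>x\<close>, and it outweighs the later inflow.\<close>
  then have gain: "real_of_int x + y / \<beta> + mean_pos / (1 - \<beta>) \<le> (real_of_int x + y) / \<beta>"
    using \<beta> by (simp add: pos_le_divide_eq algebra_simps)
  have "G M Z q \<beta> \<gamma> x (y / \<beta>) \<le> ennreal ((real_of_int x + y / \<beta> + mean_pos / (1 - \<beta>)) powr \<gamma>)"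
    using x y \<beta> by (intro G_upper) auto
  also have "\<dots> \<le> ennreal (((real_of_int x + y) / \<beta>) powr \<gamma>)"
    using gain x y \<beta> \<gamma> mean_pos_nonneg by (intro ennreal_leI powr_mono2) auto
  also have "\<dots> \<le> G M Z q \<beta> \<gamma> 0 ((real_of_int x + y) / \<beta>)"
    by (rule G_lower)
  finally show ?thesis .
qed

text \<open>
  If \<open>0\<close> were the largest maximiser, then paying out \<open>x\<close> would attain the maximum too and be a larger one.
\<close>

lemma f_star_nonzero:
  assumes x: "0 < x" "threshold \<le> real_of_int x" and y: "0 \<le> y"
  shows "f_star M Z q \<beta> \<gamma> x y \<noteq> 0"
proof
  assume zero: "f_star M Z q \<beta> \<gamma> x y = 0"
  define v where
    "v a = ennreal (\<beta> powr \<gamma>) * G M Z q \<beta> \<gamma> (x - a) ((real_of_int a + y) / \<beta>)" for a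
  define S where "S = {a. is_arg_max v (\<lambda>a. a \<in> actions x) a}"
  have f_star: "f_star M Z q \<beta> \<gamma> x y = Max S"
    unfolding f_star_def S_def v_def ..
  have fin_actions: "finite (actions x)" and actions_ne: "actions x \<noteq> {}"
    by (auto simp: actions_def)
  have S_iff: "a \<in> S \<longleftrightarrow> a \<in> actions x \<and> (\<forall>b\<in>actions x. v b \<le> v a)" for a
    by (auto simp: S_def is_arg_max_linorder)
  have fin: "finite S"
    using fin_actions by (rule rev_finite_subset) (auto simp: S_iff)
  have "S \<noteq> {}"
  proof -
    have "Max (v ` actions x) \<in> v ` actions x"
      using fin_actions actions_ne by (intro Max_in) auto
    then obtain a where a: "a \<in> actions x" "v a = Max (v ` actions x)"
      by (metis imageE)
    then have "a \<in> S"
      using fin_actions by (simp add: S_iff)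
    then show ?thesis by blast
  qed
  then have "0 \<in> S"
    using Max_in[OF fin] zero f_star by simp
  moreover have "v 0 \<le> v x"
    unfolding v_def using paying_all_beats_waiting[of x y] x y by (auto intro!: mult_left_mono)
  ultimately have "x \<in> S"
    using x by (auto simp: S_iff actions_def intro: order_trans)
  then have "x \<le> Max S"
    by (rule Max_ge[OF fin])
  then show False
    using zero f_star x by simp
qed

lemma xi_star_finite: "xi_star M Z q \<beta> \<gamma> < \<infinity>"
proof -
  define N where "N = nat \<lceil>threshold\<rceil>"
  have "xi_star M Z q \<beta> \<gamma> \<le> enat N"
    unfolding xi_star_def xi_def
  proof (intro SUP_least)
    fix y :: real and x :: nat
    assume y: "y \<in> {0..}" and x: "x \<in> {x. f_star M Z q \<beta> \<gamma> (int x) y = 0}"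
    have "x \<le> N"
    proof (rule ccontr)
      assume "\<not> x \<le> N"
      then have "0 < int x" "threshold \<le> real_of_int (int x)"
        unfolding N_def by linarith+
      then show False
        using f_star_nonzero[of "int x" y] x y by simp
    qed
    then show "enat x \<le> enat N" by simp
  qed
  then show ?thesis
    by (rule order_le_less_trans) simp
qed

end

theorem lemma4p7:
  fixes M :: "'w measure" and Z :: "nat \<Rightarrow> 'w \<Rightarrow> int" and q :: "int pmf"
    and \<beta> \<gamma> :: real
  assumes "prob_space M"
    and "prob_space.indep_vars M (\<lambda>_. count_space UNIV) Z {1..}"
    and "\<And>n k. n \<ge> 1 \<Longrightarrow> measure M {\<omega> \<in> space M. Z n \<omega> = k} = pmf q k"
    and "integrable (measure_pmf q) (\<lambda>z. real_of_int (max z 0))"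
    and "measure_pmf.prob q {z. z < 0} > 0"
    and "0 < \<beta>" and "\<beta> < 1"
    and "0 < \<gamma>" and "\<gamma> < 1"
  shows "xi_star M Z q \<beta> \<gamma> < \<infinity>"
proof -
  interpret prob_space M by fact
  interpret dividend_model M Z q \<beta> \<gamma>
    using assms by unfold_locales (auto simp: indep_vars_def)
  show ?thesis by (rule xi_star_finite)
qed

end
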